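(* Let $\mathcal{H}$ be a real-valued reproducing kernel Hilbert space over $\mathbb{R}^d$ with reproducing kernel $K$, norm $\|\cdot\|_{\mathcal{H}}$ and inner product $\langle\cdot,\cdot\rangle_{\mathcal{H}}$. Let $\mathcal{O}\subset\mathbb{R}^d$ be a (possibly infinite) set of points, and assume that functions in $\mathcal{H}$ are not uniquely determined by their values on $\mathcal{O}$ (i.e., there exist distinct $f,g\in\mathcal{H}$ with $f(u)=g(u)$ for all $u\in\mathcal{O}$). Let $\mathcal{C}\subset\mathbb{R}^{\mathcal{O}}$ be convex, let $M>0$ be a real number with $M\ge \inf\{\|f\|_{\mathcal{H}}^2 : f\in\mathcal{H},\ f_{\mathcal{O}}\in\mathcal{C}\}$, and assume that $$\mathcal{U}=\{f\in\mathcal{H} : \|f\|_{\mathcal{H}}^2\le M,\ f_{\mathcal{O}}\in\mathcal{C}\}$$ is non-empty. Let $\mathcal{S}=\overline{\operatorname{span}\{K(\cdot,u) : u\in\mathcal{O}\}}$. Then a solution $\hat f\in\mathcal{H}$ to the problem $$\sup_{f\in\mathcal{U}}\|\hat f-f\|_{\mathcal{H}}^2=\inf_{g\in\mathcal{H}}\sup_{f\in\mathcal{U}}\|g-f\|_{\mathcal{H}}^2$$ always exists and is given by the unique element $\hat f\in\overline{\mathcal{U}}\cap\mathcal{S}$ satisfying $$\|\hat f\|_{\mathcal{H}}^2=\min_{f\in\overline{\mathcal{U}}\cap\mathcal{S}}\|f\|_{\mathcal{H}}^2=\min_{f\in\overline{\mathcal{U}}}\|f\|_{\mathcal{H}}^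2.$$
   Context: $\mathbb{R}^{\mathcal{O}}$ denotes the set of all functions $\mathcal{O}\to\mathbb{R}$, and for $f\in\mathcal{H}$, $f_{\mathcal{O}}\in\mathbb{R}^{\mathcal{O}}$ denotes the restriction of $f$ to $\mathcal{O}$. An over-bar denotes closure in the norm of $\mathcal{H}$. The reproducing kernel $K$ satisfies $K(\cdot,v)\in\mathcal{H}$ and $f(v)=\langle f,K(\cdot,v)\rangle_{\mathcal{H}}$ for all $f\in\mathcal{H}$ and $v\in\mathbb{R}^d$. *)

theory Defs
  imports "HOL-Analysis.Analysis" "HOL-Library.Function_Algebras"
begin

text \<open>Pointwise scalar multiplication. Together with the pointwise addition of
  \<^theory>\<open>HOL-Library.Function_Algebras\<close> it makes \<^const>\<open>subspace\<close>, \<^const>\<open>span\<close> and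
  \<^const>\<open>convex\<close> available for sets of real-valued functions. Functions defined only on a set \<open>A\<close> are represented by
  \<^term>\<open>extensional A\<close>; this set is closed under convex (in fact affine) combinations, because
  \<open>u * undefined + v * undefined = undefined\<close> if \<open>u + v = 1\<close>. So for \<open>C \<subseteq> extensional A\<close>,
  \<^term>\<open>convex C\<close> is ordinary convexity of a set of functions on \<open>A\<close>.\<close>

instantiation "fun" :: (type, real_vector) real_vector
begin

definition "r *\<^sub>R f = (\<lambda>x. r *\<^sub>R f x)"

instance
  by standard
    (auto simp: scaleR_fun_def plus_fun_def fun_eq_iff scaleR_add_right scaleR_add_left)

end

definition hnorm :: "(('x \<Rightarrow> real) \<Rightarrow> ('x \<Rightarrow> real) \<Rightarrow> real) \<Rightarrow> ('x \<Rightarrow> real) \<Rightarrow> real"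
  where "hnorm ip f = sqrt (ip f f)"

text \<open>\<^locale>\<open>Metric_space\<close> demands nonnegativity and symmetry on the whole type, whereas \<open>ip\<close>
  is arbitrary outside \<open>H\<close>; hence the guard.\<close>

definition hdist ::
    "('x \<Rightarrow> real) set \<Rightarrow> (('x \<Rightarrow> real) \<Rightarrow> ('x \<Rightarrow> real) \<Rightarrow> real) \<Rightarrow> ('x \<Rightarrow> real) \<Rightarrow> ('x \<Rightarrow> real) \<Rightarrow> real"
  where "hdist H ip f g = (if f \<in> H \<and> g \<in> H then hnorm ip (f - g) else 0)"

definition hclosure ::
    "('x \<Rightarrow> real) set \<Rightarrow> (('x \<Rightarrow> real) \<Rightarrow> ('x \<Rightarrow> real) \<Rightarrow> real) \<Rightarrow> ('x \<Rightarrow> real) set \<Rightarrow> ('x \<Rightarrow> real) set"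
  where "hclosure H ip A = Metric_space.mtopology H (hdist H ip) closure_of A"

locale rkhs =
  fixes H :: "('x \<Rightarrow> real) set"
    and ip :: "('x \<Rightarrow> real) \<Rightarrow> ('x \<Rightarrow> real) \<Rightarrow> real"
    and K :: "'x \<Rightarrow> 'x \<Rightarrow> real"
  assumes subspace: "subspace H"
    and ip_commute: "\<lbrakk>f \<in> H; g \<in> H\<rbrakk> \<Longrightarrow> ip f g = ip g f"
    and ip_add_left: "\<lbrakk>f \<in> H; g \<in> H; h \<in> H\<rbrakk> \<Longrightarrow> ip (f + g) h = ip f h + ip g h"
    and ip_scaleR_left: "\<lbrakk>f \<in> H; g \<in> H\<rbrakk> \<Longrightarrow> ip (r *\<^sub>R f) g = r * ip f g"
    and ip_ge_zero: "f \<in> H \<Longrightarrow> 0 \<le> ip f f"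
    and ip_eq_zero_iff: "f \<in> H \<Longrightarrow> ip f f = 0 \<longleftrightarrow> f = 0"
    and complete: "Metric_space.mcomplete H (hdist H ip)"
    and kernel_in: "(\<lambda>u. K u v) \<in> H"
    and reproducing: "f \<in> H \<Longrightarrow> f v = ip f (\<lambda>u. K u v)"
begin

lemma diff_in: "\<lbrakk>f \<in> H; g \<in> H\<rbrakk> \<Longrightarrow> f - g \<in> H"
  using subspace by (rule subspace_diff)

lemma ip_add_right: "\<lbrakk>f \<in> H; g \<in> H; h \<in> H\<rbrakk> \<Longrightarrow> ip h (f + g) = ip h f + ip h g"
  by (metis ip_commute ip_add_left subspace subspace_add)

lemma ip_scaleR_right: "\<lbrakk>f \<in> H; g \<in> H\<rbrakk> \<Longrightarrow> ip f (r *\<^sub>R g) = r * ip f g"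
  by (metis ip_commute ip_scaleR_left subspace subspace_scale)

lemma ip_uminus: "f \<in> H \<Longrightarrow> ip (- f) (- f) = ip f f"
  using ip_scaleR_left[of f "- f" "-1"] ip_scaleR_right[of f f "-1"] subspace_neg[OF subspace]
  by simp

lemma ip_combination:
  assumes "f \<in> H" "g \<in> H"
  shows "ip (f + r *\<^sub>R g) (f + r *\<^sub>R g) = ip f f + 2 * r * ip f g + r\<^sup>2 * ip g g"
  using assms subspace_scale[OF subspace, of g r] subspace_add[OF subspace, of f "r *\<^sub>R g"]
  by (simp add: ip_add_left ip_add_right ip_scaleR_left ip_scaleR_right ip_commute[of g f]
      power2_eq_square algebra_simps)

lemma Cauchy_Schwarz:
  assumes "f \<in> H" "g \<in> H"
  shows "(ip f g)\<^sup>2 \<le> ip f f * ip g g"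
proof (cases "ip g g = 0")
  case True
  then have "g = 0" using assms ip_eq_zero_iff by blast
  then show ?thesis using ip_scaleR_right[of f 0 0] assms True by simp
next
  case False
  then have pos: "ip g g > 0" using assms ip_ge_zero[of g] by linarith
  let ?r = "- ip f g / ip g g"
  have "0 \<le> ip f f + 2 * ?r * ip f g + ?r\<^sup>2 * ip g g"
    using assms ip_combination[of f g ?r] ip_ge_zero[of "f + ?r *\<^sub>R g"]
      subspace_scale[OF subspace] subspace_add[OF subspace] by metis
  also have "\<dots> = ip f f - (ip f g)\<^sup>2 / ip g g"
    using pos by (simp add: power2_eq_square field_simps)
  finally show ?thesis using pos by (simp add: field_simps)
qed

lemma hnorm_triangle:
  assumes "f \<in> H" "g \<in> H"
  shows "hnorm ip (f + g) \<le> hnorm ip f + hnorm ip g"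
proof -
  have "ip f g \<le> sqrt (ip f f * ip g g)"
    using Cauchy_Schwarz[OF assms] by (metis real_le_rsqrt)
  then have "ip (f + g) (f + g) \<le> (hnorm ip f + hnorm ip g)\<^sup>2"
    using ip_combination[OF assms, of 1] assms ip_ge_zero
    by (simp add: hnorm_def power2_sum real_sqrt_mult)
  then show ?thesis
    using assms ip_ge_zero by (simp add: hnorm_def real_le_lsqrt)
qed

lemma Metric_space_hdist: "Metric_space H (hdist H ip)"
proof
  show "0 \<le> hdist H ip f g" for f g
    using diff_in ip_ge_zero by (simp add: hdist_def hnorm_def)
  show "hdist H ip f g = hdist H ip g f" for f g
    using ip_uminus[of "f - g"] diff_in by (auto simp: hdist_def hnorm_def)
  show "hdist H ip f g = 0 \<longleftrightarrow> f = g" if "f \<in> H" "g \<in> H" for f g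
    using that diff_in ip_eq_zero_iff[of "f - g"] by (simp add: hdist_def hnorm_def)
  show "hdist H ip f h \<le> hdist H ip f g + hdist H ip g h"
    if "f \<in> H" "g \<in> H" "h \<in> H" for f g h
    using hnorm_triangle[of "f - g" "g - h"] that diff_in by (simp add: hdist_def)
qed

end

definition is_min :: "real set \<Rightarrow> real \<Rightarrow> bool"
  where "is_min A m \<longleftrightarrow> m \<in> A \<and> (\<forall>a\<in>A. m \<le> a)"

end

theory Submission
  imports Defs
begin

text \<open>The element \<open>h\<close> of least norm in the closure of \<open>U\<close> exists by completeness and satisfies
  \<open>\<parallel>f - h\<parallel>\<^sup>2 \<le> \<parallel>f\<parallel>\<^sup>2 - \<parallel>h\<parallel>\<^sup>2 \<le> M - \<parallel>h\<parallel>\<^sup>2\<close> on \<open>U\<close>. Let \<open>n \<noteq> 0\<close> vanish on the observation set. Removing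
  the component along \<open>n\<close> maps \<open>U\<close> into itself and decreases the norm; hence \<open>h\<close> is orthogonal to
  every such \<open>n\<close>, that is, \<open>h \<in> S\<close>. Conversely, from any \<open>f \<in> U\<close>, freed of its component along \<open>n\<close>,
  one can move by \<open>\<plusminus>t n\<close> until the norm squared is \<open>M\<close>, staying in \<open>U\<close>; one of the two endpoints has
  squared distance at least \<open>M - \<parallel>f\<parallel>\<^sup>2\<close> from a given \<open>g\<close>. Approximating \<open>h\<close> by such \<open>f\<close> gives the
  matching lower bound \<open>M - \<parallel>h\<parallel>\<^sup>2\<close>.\<close>

context rkhs
begin

section \<open>Inner product and norm calculus in \<open>H\<close>\<close>

lemma add_in: "\<lbrakk>f \<in> H; g \<in> H\<rbrakk> \<Longrightarrow> f + g \<in> H"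
  using subspace by (rule subspace_add)

lemma scaleR_in: "f \<in> H \<Longrightarrow> r *\<^sub>R f \<in> H"
  using subspace by (rule subspace_scale)

lemma zero_in: "0 \<in> H"
  using subspace by (rule subspace_0)

lemma ip_diff_left: "\<lbrakk>f \<in> H; g \<in> H; h \<in> H\<rbrakk> \<Longrightarrow> ip (f - g) h = ip f h - ip g h"
  using ip_add_left[of "f - g" g h] by (simp add: diff_in)

lemma ip_diff_right: "\<lbrakk>f \<in> H; g \<in> H; h \<in> H\<rbrakk> \<Longrightarrow> ip h (f - g) = ip h f - ip h g"
  using ip_add_right[of "f - g" g h] by (simp add: diff_in)

lemmas in_H = add_in diff_in scaleR_in zero_in
lemmas ip_linear = ip_add_left ip_add_right ip_diff_left ip_diff_right
  ip_scaleR_left ip_scaleR_right in_H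

lemma ip_zero_left: "f \<in> H \<Longrightarrow> ip 0 f = 0"
  using ip_scaleR_left[of 0 f 0] by (simp add: zero_in)

lemma hnorm_ge_zero: "f \<in> H \<Longrightarrow> 0 \<le> hnorm ip f"
  by (simp add: hnorm_def ip_ge_zero)

lemma hnorm_power2: "f \<in> H \<Longrightarrow> (hnorm ip f)\<^sup>2 = ip f f"
  by (simp add: hnorm_def ip_ge_zero)

lemma hnorm_scaleR: "f \<in> H \<Longrightarrow> hnorm ip (r *\<^sub>R f) = \<bar>r\<bar> * hnorm ip f"
  by (simp add: hnorm_def ip_linear real_sqrt_mult flip: mult.assoc)

lemma hnorm_minus_commute:
  assumes "f \<in> H" "g \<in> H"
  shows "hnorm ip (f - g) = hnorm ip (g - f)"
  using ip_uminus[of "f - g"] assms by (simp add: hnorm_def in_H)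

lemma hdist_eq: "\<lbrakk>f \<in> H; g \<in> H\<rbrakk> \<Longrightarrow> hdist H ip f g = hnorm ip (f - g)"
  by (simp add: hdist_def)

section \<open>Norm closures and nearest points\<close>

lemma in_hclosure_iff:
  assumes "A \<subseteq> H"
  shows "f \<in> hclosure H ip A \<longleftrightarrow> f \<in> H \<and> (\<forall>e>0. \<exists>g\<in>A. hnorm ip (g - f) < e)"
proof -
  interpret Metric_space H "hdist H ip"
    by (rule Metric_space_hdist)
  have "hdist H ip f g = hnorm ip (g - f)" if "f \<in> H" "g \<in> A" for g
    using that assms hdist_eq hnorm_minus_commute by (metis subsetD)
  then show ?thesis
    using assms unfolding hclosure_def metric_closure_of in_mball
    by (smt (verit, ccfv_SIG) mem_Collect_eq subsetD in_mball)
qed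

lemma hclosure_subset: "hclosure H ip A \<subseteq> H"
proof -
  interpret Metric_space H "hdist H ip"
    by (rule Metric_space_hdist)
  show ?thesis
    using closure_of_subset_topspace[of mtopology A] by (simp add: hclosure_def)
qed

lemma subset_hclosure:
  assumes "A \<subseteq> H"
  shows "A \<subseteq> hclosure H ip A"
proof -
  interpret Metric_space H "hdist H ip"
    by (rule Metric_space_hdist)
  show ?thesis
    using closure_of_subset[of A mtopology] assms by (simp add: hclosure_def)
qed

text \<open>An approximant of \<open>f\<close> in \<open>A\<close> is sent by \<open>T\<close> to an
  equally good approximant of \<open>T f\<close> in \<open>A\<close>. This carries the invariance of
  \<open>U\<close> under removal of a component over to the closure.\<close>

lemma hclosure_nonexpansive:
  assumes "A \<subseteq> H" "f \<in> hclosure H ip A" "T \<in> H \<rightarrow> H" "T \<in> A \<rightarrow> A"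
    and "\<And>g. g \<in> H \<Longrightarrow> hnorm ip (T g - T f) \<le> hnorm ip (g - f)"
  shows "T f \<in> hclosure H ip A"
  unfolding in_hclosure_iff[OF assms(1)]
proof (intro conjI allI impI)
  have f: "f \<in> H" "\<forall>e>0. \<exists>g\<in>A. hnorm ip (g - f) < e"
    using assms(2) by (simp_all add: in_hclosure_iff[OF assms(1)])
  show "T f \<in> H" using f assms(3) by blast
  fix e :: real assume "e > 0"
  then obtain g where "g \<in> A" "hnorm ip (g - f) < e" using f by blast
  then show "\<exists>g\<in>A. hnorm ip (g - T f) < e"
    using assms(1,4,5) by (meson Pi_mem order_le_less_trans subsetD)
qed

text \<open>The coefficients are arbitrary, so that one estimate serves convex sets and subspaces
  alike.\<close>

lemma hclosure_combination:
  assumes A: "A \<subseteq> H" and comb: "\<And>f g. \<lbrakk>f \<in> A; g \<in> A\<rbrakk> \<Longrightarrow> u *\<^sub>R f + v *\<^sub>R g \<in> A"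
    and f: "f \<in> hclosure H ip A" and g: "g \<in> hclosure H ip A"
  shows "u *\<^sub>R f + v *\<^sub>R g \<in> hclosure H ip A"
  unfolding in_hclosure_iff[OF A]
proof (intro conjI allI impI)
  have fg: "f \<in> H" "g \<in> H" using f g hclosure_subset by auto
  show "u *\<^sub>R f + v *\<^sub>R g \<in> H" using fg by (simp add: in_H)
  fix e :: real assume "e > 0"
  \<comment> \<open>The summand 1 keeps the denominator positive even for \<open>u = v = 0\<close>
    and makes the final bound strict.\<close>
  define d where "d = e / (\<bar>u\<bar> + \<bar>v\<bar> + 1)"
  have "d > 0" unfolding d_def using \<open>e > 0\<close> by (simp add: add_nonneg_pos)
  then obtain f' g' where f': "f' \<in> A" "hnorm ip (f' - f) < d"
    and g': "g' \<in> A" "hnorm ip (g' - g) < d"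
    using f g unfolding in_hclosure_iff[OF A] by meson
  have in': "f' \<in> H" "g' \<in> H" using f' g' A by auto
  have "(u *\<^sub>R f' + v *\<^sub>R g') - (u *\<^sub>R f + v *\<^sub>R g) = u *\<^sub>R (f' - f) + v *\<^sub>R (g' - g)"
    by (simp add: algebra_simps)
  then have "hnorm ip ((u *\<^sub>R f' + v *\<^sub>R g') - (u *\<^sub>R f + v *\<^sub>R g))
      \<le> \<bar>u\<bar> * hnorm ip (f' - f) + \<bar>v\<bar> * hnorm ip (g' - g)"
    using hnorm_triangle[of "u *\<^sub>R (f' - f)" "v *\<^sub>R (g' - g)"] fg in'
    by (simp add: in_H hnorm_scaleR)
  also have "\<dots> \<le> \<bar>u\<bar> * d + \<bar>v\<bar> * d"
    using f' g' by (intro add_mono mult_left_mono) auto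
  also have "\<dots> < (\<bar>u\<bar> + \<bar>v\<bar> + 1) * d"
    using \<open>d > 0\<close> by (simp add: algebra_simps)
  also have "\<dots> = e"
    unfolding d_def by (simp add: add_nonneg_pos[THEN less_imp_neq, symmetric])
  finally show "\<exists>k\<in>A. hnorm ip (k - (u *\<^sub>R f + v *\<^sub>R g)) < e"
    using comb f' g' by blast
qed

lemma convex_hclosure:
  assumes "A \<subseteq> H" "convex A"
  shows "convex (hclosure H ip A)"
  using assms hclosure_combination[of A] unfolding convex_def by blast

lemma subspace_hclosure:
  assumes "A \<subseteq> H" "subspace A"
  shows "subspace (hclosure H ip A)"
proof -
  have comb: "u *\<^sub>R f + v *\<^sub>R g \<in> hclosure H ip A"
    if "f \<in> hclosure H ip A" "g \<in> hclosure H ip A" for u v f g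
    using that assms by (intro hclosure_combination subspace_add subspace_scale)
  show ?thesis
    unfolding subspace_def
    using comb[of _ _ 1 1] comb[where v = 0] subset_hclosure[OF assms(1)] subspace_0[OF assms(2)]
    by auto
qed

lemma hclosure_hclosure:
  "hclosure H ip (hclosure H ip A) = hclosure H ip A"
  by (simp add: hclosure_def)

text \<open>The nearest point, characterised by a Pythagorean inequality that contains uniqueness
  and the usual variational inequality.\<close>

lemma nearest_point:
  assumes DH: "D \<subseteq> H" and closed: "hclosure H ip D = D" and conv: "convex D"
    and ne: "D \<noteq> {}" and a: "a \<in> H"
  obtains h where "h \<in> D"
    "\<And>f. f \<in> D \<Longrightarrow> ip (a - h) (a - h) + ip (f - h) (f - h) \<le> ip (a - f) (a - f)"
proof -
  interpret Metric_space H "hdist H ip"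
    by (rule Metric_space_hdist)
  define q where "q f = ip (a - f) (a - f)" for f
  define I where "I = Inf (q ` D)"
  have bdd: "bdd_below (q ` D)"
    using DH a by (intro bdd_belowI[of _ 0]) (auto simp: q_def intro!: ip_ge_zero diff_in)
  have I_le: "I \<le> q f" if "f \<in> D" for f
    unfolding I_def using bdd that by (simp add: cINF_lower)
  have "\<exists>f\<in>D. q f < I + inverse (real (Suc n))" for n
  proof -
    have "Inf (q ` D) < I + inverse (real (Suc n))" by (simp add: I_def)
    then show ?thesis using cInf_lessD[of "q ` D"] ne by blast
  qed
  then obtain s where s: "\<And>n. s n \<in> D" "\<And>n. q (s n) < I + inverse (real (Suc n))"
    by metis
  have sH: "s n \<in> H" for n using s DH by blast
  \<comment> \<open>A weighted parallelogram law, used twice: \<open>t = 1/2\<close> makes the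
    minimising sequence Cauchy, and small \<open>t\<close> gives the Pythagorean inequality.\<close>
  have comb: "q ((1 - t) *\<^sub>R f + t *\<^sub>R g) = (1 - t) * q f + t * q g - t * (1 - t) * ip (f - g) (f - g)"
    if "f \<in> H" "g \<in> H" for f g t
    using that a ip_commute[of g f] ip_commute[of g a] ip_commute[of f a]
    by (simp add: q_def ip_linear) (simp add: algebra_simps)
  have cauchy_le: "ip (s m - s n) (s m - s n) \<le> 4 * inverse (real (Suc N))"
    if "N \<le> m" "N \<le> n" for m n N
  proof -
    have "(1 - 1/2) *\<^sub>R s m + (1/2) *\<^sub>R s n \<in> D"
      using s conv by (intro convexD) auto
    then have "I \<le> q ((1 - 1/2) *\<^sub>R s m + (1/2) *\<^sub>R s n)" by (rule I_le)
    also have "\<dots> = q (s m) / 2 + q (s n) / 2 - ip (s m - s n) (s m - s n) / 4"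
      using comb[OF sH sH, of "1/2" m n] by simp
    finally have *: "ip (s m - s n) (s m - s n) \<le> 2 * q (s m) + 2 * q (s n) - 4 * I" by simp
    have "inverse (real (Suc m)) \<le> inverse (real (Suc N))"
      "inverse (real (Suc n)) \<le> inverse (real (Suc N))"
      using that by (auto intro!: le_imp_inverse_le)
    then show ?thesis using * s(2)[of m] s(2)[of n] by linarith
  qed
  have "MCauchy s"
    unfolding MCauchy_def
  proof (intro conjI allI impI)
    show "range s \<subseteq> H" using sH by auto
    fix e :: real assume "e > 0"
    then obtain N where N: "inverse (real (Suc N)) < e\<^sup>2 / 4"
      using reals_Archimedean[of "e\<^sup>2 / 4"] by auto
    have "hdist H ip (s m) (s n) < e" if "N \<le> m" "N \<le> n" for m n
    proof -
      have "ip (s m - s n) (s m - s n) < e\<^sup>2" using cauchy_le[OF that] N by simp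
      then show ?thesis
        using \<open>e > 0\<close> by (simp add: hdist_eq sH hnorm_def real_less_lsqrt)
    qed
    then show "\<exists>N. \<forall>n n'. N \<le> n \<longrightarrow> N \<le> n' \<longrightarrow> hdist H ip (s n) (s n') < e" by blast
  qed
  then obtain h where "limitin mtopology s h sequentially"
    using complete unfolding mcomplete_def by blast
  then have hH: "h \<in> H" and lim: "\<forall>e>0. \<exists>N. \<forall>n\<ge>N. s n \<in> H \<and> hdist H ip (s n) h < e"
    by (simp_all add: limit_metric_sequentially)
  have lim': "\<exists>N. \<forall>n\<ge>N. hnorm ip (s n - h) < e" if "e > 0" for e
    using lim that sH hH by (metis hdist_eq)
  have "h \<in> hclosure H ip D"
    unfolding in_hclosure_iff[OF DH] using hH lim' s(1) by blast
  then have hD: "h \<in> D" by (simp add: closed)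
  \<comment> \<open>The infimum passes to the limit \<open>h\<close> through the triangle
    inequality, whose error terms vanish.\<close>
  have "(\<lambda>n. hnorm ip (s n - h)) \<longlonglongrightarrow> 0"
    unfolding LIMSEQ_def using lim' sH hH by (auto simp: in_H hnorm_ge_zero)
  moreover have "(\<lambda>n. sqrt (I + inverse (real (Suc n)))) \<longlonglongrightarrow> sqrt (I + 0)"
    by (intro tendsto_real_sqrt tendsto_add tendsto_const LIMSEQ_inverse_real_of_nat)
  ultimately have "(\<lambda>n. sqrt (I + inverse (real (Suc n))) + hnorm ip (s n - h)) \<longlonglongrightarrow> sqrt I"
    using tendsto_add by fastforce
  moreover have "hnorm ip (a - h) \<le> sqrt (I + inverse (real (Suc n))) + hnorm ip (s n - h)" for n
  proof -
    have "hnorm ip (a - h) \<le> hnorm ip (a - s n) + hnorm ip (s n - h)"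
      using hnorm_triangle[of "a - s n" "s n - h"] a hH sH by (simp add: in_H)
    moreover have "hnorm ip (a - s n) \<le> sqrt (I + inverse (real (Suc n)))"
      using s(2)[of n] by (simp add: hnorm_def q_def)
    ultimately show ?thesis by linarith
  qed
  ultimately have "hnorm ip (a - h) \<le> sqrt I"
    using LIMSEQ_le_const by blast
  then have qh: "q h \<le> I" by (simp add: hnorm_def q_def)
  have "q h + ip (f - h) (f - h) \<le> q f" if f: "f \<in> D" for f
  proof -
    have fH: "f \<in> H" using f DH by blast
    \<comment> \<open>Compare \<open>h\<close> with a point of the segment from \<open>h\<close> to
      \<open>f\<close> and divide by \<open>t\<close>; the factor \<open>1 - t\<close> that remains
      disappears as \<open>t\<close> tends to 0.\<close>
    have key: "q h + (1 - t) * ip (f - h) (f - h) \<le> q f" if t: "0 < t" "t < 1" for t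
    proof -
      have "(1 - t) *\<^sub>R h + t *\<^sub>R f \<in> D"
        using f hD conv t by (intro convexD) auto
      then have "q h \<le> q ((1 - t) *\<^sub>R h + t *\<^sub>R f)" using I_le qh by force
      also have "\<dots> = (1 - t) * q h + t * q f - t * (1 - t) * ip (f - h) (f - h)"
        using comb[OF hH fH, of t] ip_uminus[of "f - h"] fH hH by (simp add: in_H)
      finally have "t * (q h + (1 - t) * ip (f - h) (f - h)) \<le> t * q f"
        by (simp add: algebra_simps)
      then show ?thesis using t by simp
    qed
    have "((\<lambda>t. q h + (1 - t) * ip (f - h) (f - h)) \<longlongrightarrow> q h + (1 - 0) * ip (f - h) (f - h))
        (at_right 0)"
      by (intro tendsto_intros)
    moreover have "eventually (\<lambda>t. q h + (1 - t) * ip (f - h) (f - h) \<le> q f) (at_right 0)"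
      using key by (auto simp: eventually_at_right_field intro!: exI[of _ 1])
    ultimately have "q h + (1 - 0) * ip (f - h) (f - h) \<le> q f"
      by (intro tendsto_upperbound) auto
    then show ?thesis by simp
  qed
  then show ?thesis using that hD by (simp add: q_def)
qed

text \<open>Let \<open>p\<close> be the projection of \<open>h\<close> onto the closed span. Then
  \<open>h - p\<close> is orthogonal to the kernels at points of \<open>X\<close>, so by the
  reproducing property it vanishes on \<open>X\<close>. Hence it is orthogonal to \<open>h\<close>
  by assumption and to \<open>p\<close> by projection, thus to itself.\<close>

lemma in_hclosure_span_kernel:
  assumes hH: "h \<in> H"
    and orth: "\<And>n. \<lbrakk>n \<in> H; \<forall>u\<in>X. n u = 0\<rbrakk> \<Longrightarrow> ip h n = 0"
  shows "h \<in> hclosure H ip (span {(\<lambda>v. K v u) | u. u \<in> X})"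
proof -
  define A where "A = span {(\<lambda>v. K v u) | u. u \<in> X}"
  let ?S = "hclosure H ip A"
  have AH: "A \<subseteq> H"
    unfolding A_def using kernel_in subspace by (intro span_minimal) auto
  have subS: "subspace ?S"
    using AH unfolding A_def by (intro subspace_hclosure subspace_span)
  have S_ne: "?S \<noteq> {}"
    using subspace_0[OF subS] by blast
  obtain p where p: "p \<in> ?S"
    "\<And>f. f \<in> ?S \<Longrightarrow> ip (h - p) (h - p) + ip (f - p) (f - p) \<le> ip (h - f) (h - f)"
    by (rule nearest_point[OF hclosure_subset hclosure_hclosure
          subspace_imp_convex[OF subS] S_ne hH]) blast
  have pH: "p \<in> H" using p hclosure_subset by blast
  \<comment> \<open>Comparing \<open>p\<close> with both \<open>p + s\<close> and
    \<open>p - s\<close> bounds the inner product by 0 from either side.\<close>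
  have perp: "ip (h - p) s = 0" if s: "s \<in> ?S" for s
  proof -
    have sH: "s \<in> H" using s hclosure_subset by blast
    have "ip (h - p) (h - p) + ip s s \<le> ip (h - (p + s)) (h - (p + s))"
      using p(2)[of "p + s"] subspace_add[OF subS p(1) s] by simp
    moreover have "ip (h - p) (h - p) + ip s s \<le> ip (h - (p - s)) (h - (p - s))"
      using p(2)[of "p - s"] subspace_diff[OF subS p(1) s] ip_uminus[OF sH] by simp
    ultimately show ?thesis
      using sH hH pH ip_commute[of s h] ip_commute[of s p] by (simp add: ip_linear)
  qed
  have "(h - p) u = 0" if "u \<in> X" for u
  proof -
    have "(\<lambda>v. K v u) \<in> ?S"
      using subset_hclosure[OF AH] that unfolding A_def by (auto intro: span_base)
    then show ?thesis using perp reproducing[of "h - p" u] hH pH by (simp add: in_H)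
  qed
  then have "ip h (h - p) = 0" using orth hH pH by (simp add: in_H)
  moreover have "ip p (h - p) = 0"
    using perp[OF p(1)] ip_commute[of p "h - p"] hH pH by (simp add: in_H)
  ultimately have "ip (h - p) (h - p) = 0"
    using hH pH by (simp add: ip_diff_left in_H)
  then have "h = p" using ip_eq_zero_iff[of "h - p"] hH pH by (simp add: in_H)
  then show ?thesis using p(1) by (simp add: A_def)
qed

section \<open>Removing the component along a vector\<close>

definition reject :: "('x \<Rightarrow> real) \<Rightarrow> ('x \<Rightarrow> real) \<Rightarrow> 'x \<Rightarrow> real"
  where "reject n f = f - (ip f n / ip n n) *\<^sub>R n"

lemma reject_in: "\<lbrakk>n \<in> H; f \<in> H\<rbrakk> \<Longrightarrow> reject n f \<in> H"
  by (simp add: reject_def in_H)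

lemma ip_reject_left:
  assumes "n \<in> H" "f \<in> H" "n \<noteq> 0"
  shows "ip (reject n f) n = 0"
  using assms ip_eq_zero_iff[of n] by (simp add: reject_def ip_linear)

lemma ip_reject_self:
  assumes "n \<in> H" "f \<in> H" "n \<noteq> 0"
  shows "ip (reject n f) (reject n f) = ip f f - (ip f n)\<^sup>2 / ip n n"
proof -
  have "ip n n \<noteq> 0" using assms ip_eq_zero_iff by blast
  then show ?thesis
    using ip_combination[of f n "- ip f n / ip n n"] assms
    by (simp add: reject_def power2_eq_square field_simps)
qed

lemma ip_reject_le:
  assumes "n \<in> H" "f \<in> H" "n \<noteq> 0"
  shows "ip (reject n f) (reject n f) \<le> ip f f"
  using ip_reject_self[OF assms] ip_ge_zero[of n] assms by simp

lemma reject_diff: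
  "\<lbrakk>n \<in> H; f \<in> H; g \<in> H\<rbrakk> \<Longrightarrow> reject n f - reject n g = reject n (f - g)"
  by (simp add: reject_def ip_linear diff_divide_distrib algebra_simps)

end

section \<open>Worst-case optimality of the element of least norm\<close>

theorem theorem1:
  fixes H :: "(real ^ 'd \<Rightarrow> real) set"
    and ip :: "(real ^ 'd \<Rightarrow> real) \<Rightarrow> (real ^ 'd \<Rightarrow> real) \<Rightarrow> real"
    and K :: "real ^ 'd \<Rightarrow> real ^ 'd \<Rightarrow> real"
    and Obs :: "(real ^ 'd) set"
    and C U S :: "(real ^ 'd \<Rightarrow> real) set"
    and M :: real
  assumes "rkhs H ip K"
    and "\<exists>f\<in>H. \<exists>g\<in>H. f \<noteq> g \<and> (\<forall>u\<in>Obs. f u = g u)"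
    and "C \<subseteq> extensional Obs" and "convex C"
    and "M > 0"
    and "M \<ge> (INF f\<in>{f \<in> H. restrict f Obs \<in> C}. (hnorm ip f)\<^sup>2)"
    and "U = {f \<in> H. (hnorm ip f)\<^sup>2 \<le> M \<and> restrict f Obs \<in> C}"
    and "U \<noteq> {}"
    and "S = hclosure H ip (span {(\<lambda>v. K v u) | u. u \<in> Obs})"
  shows "\<exists>fh\<in>H.
    (SUP f\<in>U. (hnorm ip (fh - f))\<^sup>2) = (INF g\<in>H. SUP f\<in>U. (hnorm ip (g - f))\<^sup>2) \<and>
    (\<forall>h. h \<in> hclosure H ip U \<inter> S \<and>
         is_min ((\<lambda>f. (hnorm ip f)\<^sup>2) ` (hclosure H ip U \<inter> S)) ((hnorm ip h)\<^sup>2) \<and>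
         is_min ((\<lambda>f. (hnorm ip f)\<^sup>2) ` hclosure H ip U) ((hnorm ip h)\<^sup>2)
       \<longleftrightarrow> h = fh)"
proof -
  interpret rkhs H ip K by fact
  let ?cl = "hclosure H ip U"
  have UH: "U \<subseteq> H" using assms(7) by blast
  have U_iff: "f \<in> U \<longleftrightarrow> ip f f \<le> M \<and> restrict f Obs \<in> C" if "f \<in> H" for f
    using that assms(7) by (simp add: hnorm_power2)
  have hnorm_U: "hnorm ip f \<le> sqrt M" if "f \<in> U" for f
    using that UH U_iff by (auto simp: hnorm_def)
  have convU: "convex U"
  proof (rule convexI)
    fix f g and u v :: real
    assume fg: "f \<in> U" "g \<in> U" and uv: "0 \<le> u" "0 \<le> v" "u + v = 1"
    have fgH: "f \<in> H" "g \<in> H" using fg UH by auto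
    have "hnorm ip (u *\<^sub>R f + v *\<^sub>R g) \<le> u * hnorm ip f + v * hnorm ip g"
      using hnorm_triangle[of "u *\<^sub>R f" "v *\<^sub>R g"] fgH uv by (simp add: in_H hnorm_scaleR)
    also have "\<dots> \<le> sqrt M"
      using uv hnorm_U fg by (intro convex_bound_le) auto
    finally have "ip (u *\<^sub>R f + v *\<^sub>R g) (u *\<^sub>R f + v *\<^sub>R g) \<le> M"
      by (simp add: hnorm_def)
    \<comment> \<open>Off \<open>Obs\<close> both sides must be \<open>undefined\<close>; on the
      right this holds because \<open>u + v = 1\<close>.\<close>
    moreover have "restrict (u *\<^sub>R f + v *\<^sub>R g) Obs = u *\<^sub>R restrict f Obs + v *\<^sub>R restrict g Obs"
      using uv(3) by (auto simp: fun_eq_iff scaleR_fun_def simp flip: distrib_right)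
    moreover have "u *\<^sub>R restrict f Obs + v *\<^sub>R restrict g Obs \<in> C"
      using assms(4) fg fgH U_iff uv by (intro convexD) auto
    ultimately show "u *\<^sub>R f + v *\<^sub>R g \<in> U"
      using U_iff fgH by (simp add: in_H)
  qed
  have cl_ne: "?cl \<noteq> {}" using assms(8) subset_hclosure[OF UH] by blast
  \<comment> \<open>The point nearest to 0 is the element of least norm.\<close>
  obtain h where h: "h \<in> ?cl"
    and h_min': "\<And>f. f \<in> ?cl \<Longrightarrow> ip (0 - h) (0 - h) + ip (f - h) (f - h) \<le> ip (0 - f) (0 - f)"
    by (rule nearest_point[OF hclosure_subset hclosure_hclosure
          convex_hclosure[OF UH convU] cl_ne zero_in]) blast
  have clH: "f \<in> ?cl \<Longrightarrow> f \<in> H" for f using hclosure_subset by blast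
  have hH: "h \<in> H" using h clH by blast
  have h_min: "ip h h + ip (f - h) (f - h) \<le> ip f f" if "f \<in> ?cl" for f
    using h_min'[OF that] ip_uminus hH clH[OF that] by simp
  have h_le: "ip h h \<le> ip f f" if "f \<in> ?cl" for f
    using h_min[OF that] ip_ge_zero[of "f - h"] hH clH[OF that] by (simp add: in_H)

  \<comment> \<open>Directions that vanish on \<open>Obs\<close>, and their orthogonality to
    \<open>h\<close>\<close>
  have shift_in_U: "f + t *\<^sub>R n \<in> U"
    if "f \<in> U" "n \<in> H" "\<forall>u\<in>Obs. n u = 0" "ip (f + t *\<^sub>R n) (f + t *\<^sub>R n) \<le> M" for f n t
  proof -
    have "restrict (f + t *\<^sub>R n) Obs = restrict f Obs"
      using that(3) by (auto simp: fun_eq_iff scaleR_fun_def)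
    then show ?thesis using that UH U_iff[of f] U_iff[of "f + t *\<^sub>R n"] by (auto simp: in_H)
  qed
  have reject_U: "reject n f \<in> U"
    if "f \<in> U" "n \<in> H" "n \<noteq> 0" "\<forall>u\<in>Obs. n u = 0" for f n
  proof -
    have "f \<in> H" using that UH by blast
    then have "ip (reject n f) (reject n f) \<le> M"
      using ip_reject_le[of n f] that U_iff[of f] by simp
    then show ?thesis
      using shift_in_U[of f n "- (ip f n / ip n n)"] that by (simp add: reject_def)
  qed
  have orth: "ip h n = 0" if n: "n \<in> H" "\<forall>u\<in>Obs. n u = 0" for n
  proof (cases "n = 0")
    case True
    then show ?thesis using ip_zero_left[OF hH] ip_commute[OF hH zero_in] by simp
  next
    case False
    \<comment> \<open>\<open>reject n\<close> respects differences and does not increase norms, so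
      it maps the closure of \<open>U\<close> into itself.\<close>
    have nonexp: "hnorm ip (reject n g - reject n h) \<le> hnorm ip (g - h)" if "g \<in> H" for g
      using ip_reject_le[of n "g - h"] n False hH that by (simp add: reject_diff hnorm_def in_H)
    then have "reject n h \<in> ?cl"
      using UH h reject_in[OF n(1)] reject_U[OF _ n(1) False n(2)] nonexp
      by (intro hclosure_nonexpansive[where T = "reject n"]) auto
    \<comment> \<open>Otherwise \<open>reject n h\<close> would be an element of the closure with
      smaller norm than \<open>h\<close>.\<close>
    then have "(ip h n)\<^sup>2 / ip n n \<le> 0"
      using h_le ip_reject_self[OF n(1) hH False] by fastforce
    moreover have "ip n n > 0"
      using ip_ge_zero[OF n(1)] ip_eq_zero_iff[OF n(1)] False by simp
    ultimately show ?thesis by (simp add: divide_le_0_iff)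
  qed
  have hS: "h \<in> S"
    unfolding assms(9) using hH orth by (rule in_hclosure_span_kernel)

  \<comment> \<open>Lower bound for the worst-case error\<close>
  obtain n where n: "n \<in> H" "n \<noteq> 0" "\<forall>u\<in>Obs. n u = 0"
  proof -
    obtain f g where "f \<in> H" "g \<in> H" "f \<noteq> g" "\<forall>u\<in>Obs. f u = g u" using assms(2) by blast
    then show ?thesis using that[of "f - g"] by (simp add: in_H)
  qed
  have nn: "ip n n > 0"
    using ip_ge_zero[OF n(1)] ip_eq_zero_iff[OF n(1)] n by simp
  \<comment> \<open>A supremum of reals is known to dominate its members only when they are bounded
    above; here the norm bound on \<open>U\<close> ensures this.\<close>
  have bdd: "bdd_above ((\<lambda>f. (hnorm ip (g - f))\<^sup>2) ` U)" if g: "g \<in> H" for g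
  proof (rule bdd_aboveI2)
    fix f assume f: "f \<in> U"
    then have fH: "f \<in> H" using UH by blast
    have "hnorm ip (g - f) \<le> hnorm ip g + hnorm ip (0 - f)"
      using hnorm_triangle[of g "0 - f"] g diff_in[OF zero_in fH] by simp
    also have "\<dots> \<le> hnorm ip g + sqrt M"
      using hnorm_minus_commute[OF zero_in fH] hnorm_U[OF f] by simp
    finally show "(hnorm ip (g - f))\<^sup>2 \<le> (hnorm ip g + sqrt M)\<^sup>2"
      using g fH by (intro power_mono hnorm_ge_zero in_H)
  qed
  have lower: "M - ip f f \<le> (SUP f\<in>U. (hnorm ip (g - f))\<^sup>2)" if g: "g \<in> H" and f: "f \<in> U" for f g
  proof -
    have fH: "f \<in> H" using f UH by blast
    \<comment> \<open>Passing to \<open>p\<close> stays in \<open>U\<close>, can only strengthen the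
      bound to be shown, and makes the shifts along \<open>n\<close> orthogonal.\<close>
    define p where "p = reject n f"
    have pH: "p \<in> H" and pU: "p \<in> U" and pn: "ip p n = 0" and pf: "ip p p \<le> ip f f"
      unfolding p_def using reject_in reject_U ip_reject_left ip_reject_le f fH n by auto
    have pM: "ip p p \<le> M" using pU U_iff pH by blast
    \<comment> \<open>Chosen by Pythagoras so that \<open>p + t *\<^sub>R n\<close> and
      \<open>p - t *\<^sub>R n\<close> both have norm squared exactly \<open>M\<close>.\<close>
    define t where "t = sqrt ((M - ip p p) / ip n n)"
    have t2: "t\<^sup>2 * ip n n = M - ip p p"
      unfolding t_def using nn pM by simp
    have shift_U: "p + r *\<^sub>R n \<in> U" if "r\<^sup>2 = t\<^sup>2" for r
      using ip_combination[OF pH n(1), of r] pn t2 that pU n by (intro shift_in_U) simp_all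
    have U2: "p + t *\<^sub>R n \<in> U" "p + (- t) *\<^sub>R n \<in> U"
      using shift_U[of t] shift_U[of "- t"] by simp_all
    have ex: "(hnorm ip (g - (p + r *\<^sub>R n)))\<^sup>2 = ip (g - p) (g - p) - 2 * r * ip (g - p) n + r\<^sup>2 * ip n n"
      for r
      using ip_combination[of "g - p" n "- r"] g pH n
      by (simp add: hnorm_power2 in_H diff_diff_eq)
    \<comment> \<open>In \<open>ex\<close> the cross term changes sign with \<open>r\<close>, so it
      is nonnegative for \<open>t\<close> or for \<open>- t\<close>; the last term is
      \<open>M - ip p p\<close>.\<close>
    have "M - ip p p \<le> (hnorm ip (g - (p + t *\<^sub>R n)))\<^sup>2 \<or>
        M - ip p p \<le> (hnorm ip (g - (p + (- t) *\<^sub>R n)))\<^sup>2"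
      using ip_ge_zero[OF diff_in[OF g pH]] unfolding ex t2[symmetric] by auto
    moreover have "(hnorm ip (g - k))\<^sup>2 \<le> (SUP f\<in>U. (hnorm ip (g - f))\<^sup>2)" if "k \<in> U" for k
      using bdd[OF g] that by (rule cSUP_upper2[OF _ _ order_refl])
    ultimately have "M - ip p p \<le> (SUP f\<in>U. (hnorm ip (g - f))\<^sup>2)"
      using U2 by (meson order_trans)
    then show ?thesis using pf by linarith
  qed
  \<comment> \<open>\<open>h\<close> is known to lie only in the closure of \<open>U\<close>,
    whereas \<open>lower\<close> concerns members of \<open>U\<close>; the approximation error
    \<open>e\<close> is sent to 0.\<close>
  have lower_h: "M - ip h h \<le> (SUP f\<in>U. (hnorm ip (g - f))\<^sup>2)" if g: "g \<in> H" for g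
  proof -
    let ?s = "SUP f\<in>U. (hnorm ip (g - f))\<^sup>2"
    have approx: "M - ?s \<le> (hnorm ip h + e)\<^sup>2" if "e > 0" for e
    proof -
      obtain f where f: "f \<in> U" "hnorm ip (f - h) < e"
        using h \<open>e > 0\<close> unfolding in_hclosure_iff[OF UH] by blast
      have fH: "f \<in> H" using f UH by blast
      have "hnorm ip f \<le> hnorm ip h + e"
        using hnorm_triangle[of h "f - h"] hH fH f(2) by (simp add: in_H)
      then have "ip f f \<le> (hnorm ip h + e)\<^sup>2"
        using hnorm_power2[OF fH] hnorm_ge_zero[OF fH] by (metis power_mono)
      then show ?thesis using lower[OF g f(1)] by linarith
    qed
    have "((\<lambda>e. (hnorm ip h + e)\<^sup>2) \<longlongrightarrow> (hnorm ip h + 0)\<^sup>2) (at_right 0)"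
      by (intro tendsto_intros)
    moreover have "eventually (\<lambda>e. M - ?s \<le> (hnorm ip h + e)\<^sup>2) (at_right 0)"
      using approx by (auto simp: eventually_at_right_field intro!: exI[of _ 1])
    ultimately have "M - ?s \<le> (hnorm ip h + 0)\<^sup>2"
      by (intro tendsto_lowerbound) auto
    then show ?thesis using hnorm_power2[OF hH] by simp
  qed

  \<comment> \<open>The bound is attained at \<open>h\<close>, and \<open>h\<close> is the unique
    minimiser\<close>
  have "(SUP f\<in>U. (hnorm ip (h - f))\<^sup>2) \<le> M - ip h h"
  proof (rule cSUP_least[OF assms(8)])
    fix f assume f: "f \<in> U"
    then have fH: "f \<in> H" and "f \<in> ?cl" using UH subset_hclosure[OF UH] by auto
    then have "ip (f - h) (f - h) \<le> ip f f - ip h h" using h_min by fastforce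
    then show "(hnorm ip (h - f))\<^sup>2 \<le> M - ip h h"
      using U_iff[OF fH] f hnorm_minus_commute[OF hH fH] hnorm_power2[OF diff_in[OF fH hH]] by simp
  qed
  moreover have "M - ip h h \<le> (INF g\<in>H. SUP f\<in>U. (hnorm ip (g - f))\<^sup>2)"
    using hH lower_h by (intro cINF_greatest) auto
  \<comment> \<open>Here \<open>lower_h\<close> acts as the bound from below that makes the infimum
    a genuine lower bound.\<close>
  moreover have "(INF g\<in>H. SUP f\<in>U. (hnorm ip (g - f))\<^sup>2) \<le> (SUP f\<in>U. (hnorm ip (h - f))\<^sup>2)"
    using hH lower_h by (intro cINF_lower bdd_belowI2)
  ultimately have opt: "(SUP f\<in>U. (hnorm ip (h - f))\<^sup>2) = (INF g\<in>H. SUP f\<in>U. (hnorm ip (g - f))\<^sup>2)"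
    by linarith
  \<comment> \<open>Taking for \<open>A\<close> the closure of \<open>U\<close> and its intersection
    with \<open>S\<close> gives both minima; the second choice relies on \<open>hS\<close>.\<close>
  have min_h: "is_min ((\<lambda>f. (hnorm ip f)\<^sup>2) ` A) ((hnorm ip h)\<^sup>2)" if "h \<in> A" "A \<subseteq> ?cl" for A
    using that h_le clH hH unfolding is_min_def by (auto simp: hnorm_power2 subset_iff)
  have unique: "k = h" if k: "k \<in> ?cl" "is_min ((\<lambda>f. (hnorm ip f)\<^sup>2) ` ?cl) ((hnorm ip k)\<^sup>2)" for k
  proof -
    have kH: "k \<in> H" using k clH by blast
    have "(hnorm ip k)\<^sup>2 \<le> (hnorm ip h)\<^sup>2" using k(2) h unfolding is_min_def by blast
    then have "ip k k \<le> ip h h" by (simp add: hnorm_power2 kH hH)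
    \<comment> \<open>The Pythagorean defect in \<open>h_min\<close> is squeezed to 0 when the norms
      agree.\<close>
    then have "ip (k - h) (k - h) = 0"
      using h_min[OF k(1)] ip_ge_zero[OF diff_in[OF kH hH]] by linarith
    then show ?thesis using ip_eq_zero_iff[OF diff_in[OF kH hH]] by simp
  qed
  have "k \<in> ?cl \<inter> S \<and>
         is_min ((\<lambda>f. (hnorm ip f)\<^sup>2) ` (?cl \<inter> S)) ((hnorm ip k)\<^sup>2) \<and>
         is_min ((\<lambda>f. (hnorm ip f)\<^sup>2) ` ?cl) ((hnorm ip k)\<^sup>2)
       \<longleftrightarrow> k = h" for k
    using h hS min_h[of "?cl \<inter> S"] min_h[of ?cl] unique by blast
  then show ?thesis using hH opt by blast
qed

end
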